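(* The logic $\mathrm{Tack}_2$ is prelocally tabular, i.e., every proper normal extension of $\mathrm{Tack}_2$ (in the bimodal language with $\lozenge_1,\lozenge_2$) is locally tabular.
   Context: For sets $X,Y$, let $\mathrm{T}(X,Y)$ be the bimodal frame with domain $(X\times Y)\cup\{t\}$ ($t$ a new point) and relations $R_1=\{((a,b),(a',b)):a,a'\in X,b\in Y\}\cup((X\times Y)\times\{t\})\cup\{(t,t)\}$ and $R_2=\{((a,b),(a,b')):a\in X,b,b'\in Y\}\cup\{(t,t)\}$ (the "two-dimensional tack"; $R_1$ interprets $\lozenge_1$, $R_2$ interprets $\lozenge_2$). $\mathrm{Tack}_2$ is the set of bimodal formulas valid in $\mathrm{T}(\omega,\omega)$. A logic is locally tabular if for each finite $k$ it has only finitely many pairwise nonequivalent formulas in $k$ variables. *)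

theory Defs
  imports Main
begin

datatype modality = M1 | M2

datatype fm = Var nat | Bot | Imp fm fm | Dia modality fm

definition Neg :: "fm \<Rightarrow> fm" where
  "Neg \<phi> = Imp \<phi> Bot"

definition Disj :: "fm \<Rightarrow> fm \<Rightarrow> fm" where
  "Disj \<phi> \<psi> = Imp (Neg \<phi>) \<psi>"

definition Conj :: "fm \<Rightarrow> fm \<Rightarrow> fm" where
  "Conj \<phi> \<psi> = Neg (Imp \<phi> (Neg \<psi>))"

definition Iff :: "fm \<Rightarrow> fm \<Rightarrow> fm" where
  "Iff \<phi> \<psi> = Conj (Imp \<phi> \<psi>) (Imp \<psi> \<phi>)"

primrec vars :: "fm \<Rightarrow> nat set" where
  "vars (Var p) = {p}"
| "vars Bot = {}"
| "vars (Imp \<phi> \<psi>) = vars \<phi> \<union> vars \<psi>"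
| "vars (Dia m \<phi>) = vars \<phi>"

primrec subst :: "(nat \<Rightarrow> fm) \<Rightarrow> fm \<Rightarrow> fm" where
  "subst \<sigma> (Var p) = \<sigma> p"
| "subst \<sigma> Bot = Bot"
| "subst \<sigma> (Imp \<phi> \<psi>) = Imp (subst \<sigma> \<phi>) (subst \<sigma> \<psi>)"
| "subst \<sigma> (Dia m \<phi>) = Dia m (subst \<sigma> \<phi>)"

text \<open>Boolean evaluation: variables and formulas beginning with a diamond are the atoms,
  so \<open>tautology\<close> holds exactly of the substitution instances of classical tautologies.\<close>

primrec bool_eval :: "(fm \<Rightarrow> bool) \<Rightarrow> fm \<Rightarrow> bool" where
  "bool_eval v (Var p) = v (Var p)"
| "bool_eval v Bot = False"
| "bool_eval v (Imp \<phi> \<psi>) = (bool_eval v \<phi> \<longrightarrow> bool_eval v \<psi>)"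
| "bool_eval v (Dia m \<phi>) = v (Dia m \<phi>)"

definition tautology :: "fm \<Rightarrow> bool" where
  "tautology \<phi> \<longleftrightarrow> (\<forall>v. bool_eval v \<phi>)"

definition normal_logic :: "fm set \<Rightarrow> bool" where
  "normal_logic L \<longleftrightarrow>
     (\<forall>\<phi>. tautology \<phi> \<longrightarrow> \<phi> \<in> L) \<and>
     (\<forall>m. Neg (Dia m Bot) \<in> L) \<and>
     (\<forall>m. Imp (Dia m (Disj (Var 0) (Var 1))) (Disj (Dia m (Var 0)) (Dia m (Var 1))) \<in> L) \<and>
     (\<forall>\<phi> \<psi>. Imp \<phi> \<psi> \<in> L \<longrightarrow> \<phi> \<in> L \<longrightarrow> \<psi> \<in> L) \<and>
     (\<forall>\<sigma> \<phi>. \<phi> \<in> L \<longrightarrow> subst \<sigma> \<phi> \<in> L) \<and>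
     (\<forall>m \<phi> \<psi>. Imp \<phi> \<psi> \<in> L \<longrightarrow> Imp (Dia m \<phi>) (Dia m \<psi>) \<in> L)"

record 'w kripke_frame =
  worlds :: "'w set"
  rel :: "modality \<Rightarrow> ('w \<times> 'w) set"

primrec sat :: "'w kripke_frame \<Rightarrow> (nat \<Rightarrow> 'w set) \<Rightarrow> 'w \<Rightarrow> fm \<Rightarrow> bool" where
  "sat F V w (Var p) = (w \<in> V p)"
| "sat F V w Bot = False"
| "sat F V w (Imp \<phi> \<psi>) = (sat F V w \<phi> \<longrightarrow> sat F V w \<psi>)"
| "sat F V w (Dia m \<phi>) = (\<exists>u \<in> worlds F. (w, u) \<in> rel F m \<and> sat F V u \<phi>)"

definition valid :: "'w kripke_frame \<Rightarrow> fm \<Rightarrow> bool" where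
  "valid F \<phi> \<longleftrightarrow> (\<forall>V. (\<forall>p. V p \<subseteq> worlds F) \<longrightarrow> (\<forall>w \<in> worlds F. sat F V w \<phi>))"

text \<open>The point \<open>Some (a, b)\<close> is the pair \<open>(a, b)\<close>, and \<open>None\<close> is the new point \<open>t\<close>.\<close>

definition tack_rel1 :: "'a set \<Rightarrow> 'b set \<Rightarrow> (('a \<times> 'b) option \<times> ('a \<times> 'b) option) set" where
  "tack_rel1 X Y =
     {(Some (a, b), Some (a', b)) | a a' b. a \<in> X \<and> a' \<in> X \<and> b \<in> Y}
     \<union> (Some ` (X \<times> Y)) \<times> {None} \<union> {(None, None)}"

definition tack_rel2 :: "'a set \<Rightarrow> 'b set \<Rightarrow> (('a \<times> 'b) option \<times> ('a \<times> 'b) option) set" where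
  "tack_rel2 X Y =
     {(Some (a, b), Some (a, b')) | a b b'. a \<in> X \<and> b \<in> Y \<and> b' \<in> Y} \<union> {(None, None)}"

definition tack :: "'a set \<Rightarrow> 'b set \<Rightarrow> ('a \<times> 'b) option kripke_frame" where
  "tack X Y =
     \<lparr> worlds = Some ` (X \<times> Y) \<union> {None},
       rel = (\<lambda>m. case m of M1 \<Rightarrow> tack_rel1 X Y | M2 \<Rightarrow> tack_rel2 X Y) \<rparr>"

definition Tack2 :: "fm set" where
  "Tack2 = {\<phi>. valid (tack (UNIV :: nat set) (UNIV :: nat set)) \<phi>}"

definition fms :: "nat \<Rightarrow> fm set" where
  "fms k = {\<phi>. vars \<phi> \<subseteq> {..<k}}"

definition equivalent_in :: "fm set \<Rightarrow> nat \<Rightarrow> (fm \<times> fm) set" where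
  "equivalent_in L k = {(\<phi>, \<psi>). \<phi> \<in> fms k \<and> \<psi> \<in> fms k \<and> Iff \<phi> \<psi> \<in> L}"

definition locally_tabular :: "fm set \<Rightarrow> bool" where
  "locally_tabular L \<longleftrightarrow> (\<forall>k. finite (fms k // equivalent_in L k))"

definition prelocally_tabular :: "fm set \<Rightarrow> bool" where
  "prelocally_tabular L \<longleftrightarrow> (\<forall>L'. normal_logic L' \<and> L \<subset> L' \<longrightarrow> locally_tabular L')"

end

theory Submission
  imports Defs
begin

text \<open>
  A formula outside the logic is refuted in a finite tack, so a model on the infinite tack refutes one
  of its substitution instances as soon as it has, by formulas of bounded depth, enough definable
  classes of rows and enough definable classes of columns: these give a definable bounded morphism
  onto the finite tack. (The top point is definable unless all points have the same colour.)
  If the instances of bounded depth all hold, then in one direction the lines fall into boundedly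
  many classes. By the pigeonhole principle the algebra of definable sets of lines is then
  stable from some depth \<open>d\<close> to \<open>d + 2\<close>, and two points are bisimilar if they agree on the colour,
  on the class of their line, and on which colours occur in which line classes on the crossing line.
  The resulting quotients have bounded size, so the truth table over models of that size determines
  a formula up to equivalence in the extension. Only finitely many instances are involved, so this
  is an implication valid in the infinite tack, and no completeness of the extension is needed.
\<close>

section \<open>Semantics\<close>

abbreviation TT :: "(nat \<times> nat) option kripke_frame" where
  "TT \<equiv> tack (UNIV :: nat set) (UNIV :: nat set)"

lemma sat_connectives [simp]:
  "sat F V w (Neg \<phi>) \<longleftrightarrow> \<not> sat F V w \<phi>"
  "sat F V w (Disj \<phi> \<psi>) \<longleftrightarrow> sat F V w \<phi> \<or> sat F V w \<psi>"
  "sat F V w (Conj \<phi> \<psi>) \<longleftrightarrow> sat F V w \<phi> \<and> sat F V w \<psi>"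
  "sat F V w (Iff \<phi> \<psi>) \<longleftrightarrow> (sat F V w \<phi> \<longleftrightarrow> sat F V w \<psi>)"
  by (auto simp: Neg_def Disj_def Conj_def Iff_def)

lemma bool_eval_connectives [simp]:
  "bool_eval v (Neg \<phi>) \<longleftrightarrow> \<not> bool_eval v \<phi>"
  "bool_eval v (Disj \<phi> \<psi>) \<longleftrightarrow> bool_eval v \<phi> \<or> bool_eval v \<psi>"
  "bool_eval v (Conj \<phi> \<psi>) \<longleftrightarrow> bool_eval v \<phi> \<and> bool_eval v \<psi>"
  "bool_eval v (Iff \<phi> \<psi>) \<longleftrightarrow> (bool_eval v \<phi> \<longleftrightarrow> bool_eval v \<psi>)"
  by (auto simp: Neg_def Disj_def Conj_def Iff_def)

lemma worlds_tack [simp]: "worlds (tack X Y) = Some ` (X \<times> Y) \<union> {None}"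
  by (simp add: tack_def)

lemma worlds_TT [simp]: "w \<in> worlds TT"
  by (cases w) auto

lemma rel_tack:
  "rel (tack X Y) M1 = tack_rel1 X Y"
  "rel (tack X Y) M2 = tack_rel2 X Y"
  by (simp_all add: tack_def)

lemma sat_tack_None [simp]:
  "sat (tack X Y) V None (Dia m \<phi>) \<longleftrightarrow> sat (tack X Y) V None \<phi>"
  by (cases m) (auto simp: rel_tack tack_rel1_def tack_rel2_def)

lemma sat_tack_Some:
  assumes "a \<in> X" "b \<in> Y"
  shows "sat (tack X Y) V (Some (a, b)) (Dia M1 \<phi>) \<longleftrightarrow>
           (\<exists>a'\<in>X. sat (tack X Y) V (Some (a', b)) \<phi>) \<or> sat (tack X Y) V None \<phi>"
    and "sat (tack X Y) V (Some (a, b)) (Dia M2 \<phi>) \<longleftrightarrow>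
           (\<exists>b'\<in>Y. sat (tack X Y) V (Some (a, b')) \<phi>)"
  using assms by (auto simp: rel_tack tack_rel1_def tack_rel2_def)

lemmas sat_TT_Some [simp] = sat_tack_Some[OF UNIV_I UNIV_I]

declare sat.simps(4) [simp del]

section \<open>The finite model property of the tack logic\<close>

primrec subformulas :: "fm \<Rightarrow> fm set" where
  "subformulas (Var p) = {Var p}"
| "subformulas Bot = {Bot}"
| "subformulas (Imp \<phi> \<psi>) = insert (Imp \<phi> \<psi>) (subformulas \<phi> \<union> subformulas \<psi>)"
| "subformulas (Dia m \<phi>) = insert (Dia m \<phi>) (subformulas \<phi>)"

lemma finite_subformulas [simp]: "finite (subformulas \<phi>)"
  by (induction \<phi>) auto

lemma subformulas_refl [simp]: "\<phi> \<in> subformulas \<phi>"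
  by (cases \<phi>) auto

lemma subformulas_trans:
  "\<psi> \<in> subformulas \<phi> \<Longrightarrow> subformulas \<psi> \<subseteq> subformulas \<phi>"
  by (induction \<phi>) auto

text \<open>The first \<open>N\<close> slots exhaust the values of \<open>t\<close> on
  \<open>P\<close>. Surplus slots hold a default point, so the listing may be indexed by residues
  modulo \<open>N\<close>.\<close>

lemma enumerate_values:
  assumes "finite (t ` P)" "P \<noteq> {}" "card (t ` P) \<le> N"
  shows "\<exists>e. (\<forall>z::nat. e z \<in> P) \<and> (\<forall>q\<in>P. \<exists>z<N. t (e z) = t q)"
proof -
  obtain h where h: "bij_betw h {0..<card (t ` P)} (t ` P)"
    using ex_bij_betw_nat_finite[OF assms(1)] by blast
  obtain q0 where q0: "q0 \<in> P" using assms(2) by blast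
  define e where "e z = (if z < card (t ` P) then SOME q. q \<in> P \<and> t q = h z else q0)" for z
  have e: "e z \<in> P \<and> t (e z) = h z" if "z < card (t ` P)" for z
  proof -
    have "h z \<in> t ` P" using h that by (auto simp: bij_betw_def)
    then have "\<exists>q. q \<in> P \<and> t q = h z" by auto
    from someI_ex[OF this] show ?thesis using that by (simp add: e_def)
  qed
  have "e z \<in> P" for z using e q0 by (cases "z < card (t ` P)") (auto simp: e_def)
  moreover have "\<exists>z<N. t (e z) = t q" if "q \<in> P" for q
  proof -
    have "t q \<in> h ` {0..<card (t ` P)}" using h that by (auto simp: bij_betw_def)
    then obtain z where "z < card (t ` P)" "h z = t q" by auto
    then show ?thesis using e assms(3) by (metis order_less_le_trans)
  qed
  ultimately show ?thesis by blast
qed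

text \<open>Columns and rows are first collapsed to finitely many kinds. A block of a column kind and a
  row kind is then filled with all types occurring there so that each type occurs in every row and
  every column of the block: the entry at \<open>(z, z')\<close> depends on \<open>z + z'\<close> modulo \<open>N\<close>.\<close>

lemma tack_finite_model_property:
  assumes "\<phi> \<notin> Tack2"
  shows "\<exists>(X :: (nat \<times> nat) set) (Y :: (nat \<times> nat) set) V w. finite X \<and> finite Y \<and> X \<noteq> {} \<and> Y \<noteq> {} \<and>
     w \<in> worlds (tack X Y) \<and> \<not> sat (tack X Y) V w \<phi>"
proof -
  obtain V1 w1 where w1: "\<not> sat TT V1 w1 \<phi>"
    using assms by (auto simp: Tack2_def valid_def)
  define \<Sigma> where "\<Sigma> = subformulas \<phi>"
  define tp where "tp w = {\<psi> \<in> \<Sigma>. sat TT V1 w \<psi>}" for w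
  define rt where "rt b = range (\<lambda>a. tp (Some (a, b)))" for b
  define ct where "ct a = range (\<lambda>b. tp (Some (a, b)))" for a
  \<comment> \<open>\<open>N\<close> bounds the number of types in any block, so all blocks can
    share one side length.\<close>
  define N where "N = card (Pow \<Sigma>)"
  define r1 where "r1 a = inv ct (ct a)" for a
  define r2 where "r2 b = inv rt (rt b)" for b
  have fin\<Sigma>: "finite \<Sigma>" by (simp add: \<Sigma>_def)
  have tp_sub: "tp w \<in> Pow \<Sigma>" for w by (auto simp: tp_def)
  have N0: "N > 0" using fin\<Sigma> by (simp add: N_def card_Pow)
  have r1: "ct (r1 a) = ct a" for a by (simp add: r1_def f_inv_into_f)
  have r2: "rt (r2 a) = rt a" for a by (simp add: r2_def f_inv_into_f)
  have "range ct \<subseteq> Pow (Pow \<Sigma>)" "range rt \<subseteq> Pow (Pow \<Sigma>)"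
    using tp_sub by (auto simp: ct_def rt_def)
  then have "finite (range ct)" "finite (range rt)"
    using fin\<Sigma> by (meson finite_Pow_iff finite_subset)+
  moreover have "range r1 = inv ct ` range ct" "range r2 = inv rt ` range rt"
    by (auto simp: r1_def r2_def)
  ultimately have fr: "finite (range r1)" "finite (range r2)" by simp_all
  define P where "P a b = {(a', b'). ct a' = ct a \<and> rt b' = rt b}" for a b
  have "\<exists>e. (\<forall>z::nat. e z \<in> P a b) \<and> (\<forall>q\<in>P a b. \<exists>z<N. tp (Some (e z)) = tp (Some q))" for a b
  proof -
    have sub: "(\<lambda>q. tp (Some q)) ` P a b \<subseteq> Pow \<Sigma>" using tp_sub by auto
    have "(a, b) \<in> P a b" by (simp add: P_def)
    then show ?thesis
      using enumerate_values[of "\<lambda>q. tp (Some q)" "P a b" N] sub fin\<Sigma>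
      by (metis N_def card_mono empty_iff finite_Pow_iff finite_subset)
  qed
  then obtain e where eP: "\<And>a b z. e a b z \<in> P a b"
    and eS: "\<And>a b q. q \<in> P a b \<Longrightarrow> \<exists>z<N. tp (Some (e a b z)) = tp (Some q)"
    by metis
  define X where "X = range r1 \<times> {..<N}"
  define Y where "Y = range r2 \<times> {..<N}"
  \<comment> \<open>Only types are preserved along a line: two points of one row may be sent to
    different rows, but these rows realize the same types.\<close>
  define E where "E w = (case w of None \<Rightarrow> None
     | Some ((a, z), (b, z')) \<Rightarrow> Some (e a b ((z + z') mod N)))" for w :: "((nat \<times> nat) \<times> (nat \<times> nat)) option"
  have E_simps: "E None = None" "E (Some ((a, z), (b, z'))) = Some (e a b ((z + z') mod N))" for a z b z'
    by (simp_all add: E_def)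
  define V where "V p = {x. E x \<in> V1 p}" for p
  \<comment> \<open>Along a line of a block the index \<open>z + z'\<close> runs through all
    residues, so each slot is met.\<close>
  have shift: "\<exists>y<N. (y + z) mod N = x" if "x < N" "z < N" for x z
    using that by (intro exI[of _ "(x + (N - z)) mod N"]) (simp add: mod_add_left_eq)
  have transfer: "sat TT V1 u \<psi>" if "sat TT V1 w \<psi>" "tp w = tp u" "\<psi> \<in> \<Sigma>" for u w \<psi>
    using that by (auto simp: tp_def)
  have main: "sat (tack X Y) V w \<psi> \<longleftrightarrow> sat TT V1 (E w) \<psi>"
    if "w \<in> worlds (tack X Y)" "\<psi> \<in> \<Sigma>" for w \<psi>
    using that
  proof (induction \<psi> arbitrary: w)
    case (Imp \<psi>1 \<psi>2)
    then have "\<psi>1 \<in> \<Sigma>" "\<psi>2 \<in> \<Sigma>"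
      using subformulas_trans[of "Imp \<psi>1 \<psi>2" \<phi>] by (auto simp: \<Sigma>_def)
    with Imp show ?case by simp
  next
    case (Dia m \<psi>)
    have \<psi>: "\<psi> \<in> \<Sigma>"
      using subformulas_trans[of "Dia m \<psi>" \<phi>] Dia.prems by (auto simp: \<Sigma>_def)
    note IH = Dia.IH[OF _ \<psi>]
    have N: "sat (tack X Y) V None \<psi> \<longleftrightarrow> sat TT V1 None \<psi>"
      using IH[of None] by (simp add: E_simps)
    show ?case
    proof (cases w)
      case None
      then show ?thesis using N by (simp add: E_simps)
    next
      case (Some q)
      then obtain a z b z' where w: "w = Some ((a, z), (b, z'))" by (metis surj_pair)
      have aX: "(a, z) \<in> X" and bY: "(b, z') \<in> Y" using Dia.prems w by auto
      then have z: "z < N" "z' < N" by (auto simp: X_def Y_def)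
      obtain a' b' where ab': "e a b ((z + z') mod N) = (a', b')" by (metis surj_pair)
      then have ab: "ct a' = ct a" "rt b' = rt b"
        using eP[of a b "(z + z') mod N"] by (auto simp: P_def)
      show ?thesis
      proof (cases m)
        case M1
        have "(\<exists>c\<in>X. sat (tack X Y) V (Some (c, (b, z'))) \<psi>) \<longleftrightarrow> (\<exists>c. sat TT V1 (Some (c, b')) \<psi>)"
        proof
          assume "\<exists>c\<in>X. sat (tack X Y) V (Some (c, (b, z'))) \<psi>"
          then obtain a2 z2 where c: "(a2, z2) \<in> X" "sat (tack X Y) V (Some ((a2, z2), (b, z'))) \<psi>"
            by auto
          obtain u v where uv: "e a2 b ((z2 + z') mod N) = (u, v)" by (metis surj_pair)
          have s: "sat TT V1 (Some (u, v)) \<psi>"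
            using IH[of "Some ((a2, z2), (b, z'))"] c bY uv by (auto simp: E_simps)
          \<comment> \<open>The witness may lie outside row \<open>b'\<close>, but rows of one kind
            realize the same types.\<close>
          have "rt v = rt b'" using eP[of a2 b "(z2 + z') mod N"] uv ab by (auto simp: P_def)
          then have "tp (Some (u, v)) \<in> rt b'" by (auto simp: rt_def)
          then obtain c where "tp (Some (u, v)) = tp (Some (c, b'))" by (auto simp: rt_def)
          then show "\<exists>c. sat TT V1 (Some (c, b')) \<psi>" using transfer[OF s _ \<psi>] by blast
        next
          assume "\<exists>c. sat TT V1 (Some (c, b')) \<psi>"
          then obtain c where c: "sat TT V1 (Some (c, b')) \<psi>" by blast
          \<comment> \<open>Some slot of the block of \<open>r1 c\<close> and \<open>b\<close>
            carries the type of \<open>(c, b')\<close>; the copy \<open>y\<close> of the column is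
            chosen to bring that slot into row copy \<open>z'\<close>.\<close>
          have "(c, b') \<in> P (r1 c) b" using ab r1 by (auto simp: P_def)
          from eS[OF this] obtain z3 where z3: "z3 < N" "tp (Some (e (r1 c) b z3)) = tp (Some (c, b'))"
            by blast
          obtain y where y: "y < N" "(y + z') mod N = z3" using shift[OF z3(1) z(2)] by blast
          have "sat TT V1 (Some (e (r1 c) b z3)) \<psi>" using transfer[OF c _ \<psi>] z3 by metis
          moreover have yX: "(r1 c, y) \<in> X" using y by (auto simp: X_def)
          ultimately have "sat (tack X Y) V (Some ((r1 c, y), (b, z'))) \<psi>"
            using IH[of "Some ((r1 c, y), (b, z'))"] bY y by (auto simp: E_simps)
          then show "\<exists>c\<in>X. sat (tack X Y) V (Some (c, (b, z'))) \<psi>" using yX by blast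
        qed
        then show ?thesis using N aX bY by (simp add: M1 w E_simps ab' sat_tack_Some)
      next
        case M2
        have "(\<exists>c\<in>Y. sat (tack X Y) V (Some ((a, z), c)) \<psi>) \<longleftrightarrow> (\<exists>c. sat TT V1 (Some (a', c)) \<psi>)"
        proof
          assume "\<exists>c\<in>Y. sat (tack X Y) V (Some ((a, z), c)) \<psi>"
          then obtain b2 z2 where c: "(b2, z2) \<in> Y" "sat (tack X Y) V (Some ((a, z), (b2, z2))) \<psi>"
            by auto
          obtain u v where uv: "e a b2 ((z + z2) mod N) = (u, v)" by (metis surj_pair)
          have s: "sat TT V1 (Some (u, v)) \<psi>"
            using IH[of "Some ((a, z), (b2, z2))"] c aX uv by (auto simp: E_simps)
          have "ct u = ct a'" using eP[of a b2 "(z + z2) mod N"] uv ab by (auto simp: P_def)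
          then have "tp (Some (u, v)) \<in> ct a'" by (auto simp: ct_def)
          then obtain c where "tp (Some (u, v)) = tp (Some (a', c))" by (auto simp: ct_def)
          then show "\<exists>c. sat TT V1 (Some (a', c)) \<psi>" using transfer[OF s _ \<psi>] by blast
        next
          assume "\<exists>c. sat TT V1 (Some (a', c)) \<psi>"
          then obtain c where c: "sat TT V1 (Some (a', c)) \<psi>" by blast
          have "(a', c) \<in> P a (r2 c)" using ab r2 by (auto simp: P_def)
          from eS[OF this] obtain z3 where z3: "z3 < N" "tp (Some (e a (r2 c) z3)) = tp (Some (a', c))"
            by blast
          obtain y where y: "y < N" "(z + y) mod N = z3"
            using shift[OF z3(1) z(1)] by (auto simp: add.commute)
          have "sat TT V1 (Some (e a (r2 c) z3)) \<psi>" using transfer[OF c _ \<psi>] z3 by metis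
          moreover have yY: "(r2 c, y) \<in> Y" using y by (auto simp: Y_def)
          ultimately have "sat (tack X Y) V (Some ((a, z), (r2 c, y))) \<psi>"
            using IH[of "Some ((a, z), (r2 c, y))"] aX y by (auto simp: E_simps)
          then show "\<exists>c\<in>Y. sat (tack X Y) V (Some ((a, z), c)) \<psi>" using yY by blast
        qed
        then show ?thesis using aX bY by (simp add: M2 w E_simps ab' sat_tack_Some)
      qed
    qed
  qed (auto simp: V_def)
  have \<phi>: "\<phi> \<in> \<Sigma>" by (simp add: \<Sigma>_def)
  have "\<exists>w\<in>worlds (tack X Y). \<not> sat (tack X Y) V w \<phi>"
  proof (cases w1)
    case None
    then show ?thesis using main[of None, OF _ \<phi>] w1 by (simp add: E_simps)
  next
    case (Some q)
    then obtain a b where w: "w1 = Some (a, b)" by (metis surj_pair)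
    have "(a, b) \<in> P (r1 a) (r2 b)" by (simp add: P_def r1 r2)
    from eS[OF this] obtain z where z: "z < N" "tp (Some (e (r1 a) (r2 b) z)) = tp w1"
      using w by blast
    let ?w = "Some ((r1 a, z), (r2 b, 0))"
    have "\<not> sat TT V1 (E ?w) \<phi>" using w1 z transfer[OF _ _ \<phi>] by (auto simp: E_simps)
    moreover have "?w \<in> worlds (tack X Y)" using z N0 by (auto simp: X_def Y_def)
    ultimately show ?thesis using main[OF _ \<phi>] by blast
  qed
  moreover have "finite X" "finite Y" "X \<noteq> {}" "Y \<noteq> {}"
    using fr N0 by (auto simp: X_def Y_def)
  ultimately show ?thesis by blast
qed


section \<open>Formulas of bounded modal depth\<close>

primrec modal_depth :: "fm \<Rightarrow> nat" where
  "modal_depth (Var p) = 0"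
| "modal_depth Bot = 0"
| "modal_depth (Imp \<phi> \<psi>) = max (modal_depth \<phi>) (modal_depth \<psi>)"
| "modal_depth (Dia m \<phi>) = Suc (modal_depth \<phi>)"

definition fms_depth :: "nat \<Rightarrow> nat \<Rightarrow> fm set" where
  "fms_depth k d = {\<phi> \<in> fms k. modal_depth \<phi> \<le> d}"

lemma fms_depth_simps [simp]:
  "Var p \<in> fms_depth k d \<longleftrightarrow> p < k"
  "Bot \<in> fms_depth k d"
  "Imp \<phi> \<psi> \<in> fms_depth k d \<longleftrightarrow> \<phi> \<in> fms_depth k d \<and> \<psi> \<in> fms_depth k d"
  "Dia m \<phi> \<in> fms_depth k (Suc d) \<longleftrightarrow> \<phi> \<in> fms_depth k d"
  "Dia m \<phi> \<notin> fms_depth k 0"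
  by (auto simp: fms_depth_def fms_def)

text \<open>Truth over all valuations and points at once: equal extensions mean equivalence on the
  infinite tack uniformly in the valuation.\<close>

definition extension :: "fm \<Rightarrow> (nat \<Rightarrow> (nat \<times> nat) option set) \<times> (nat \<times> nat) option \<Rightarrow> bool" where
  "extension \<phi> = (\<lambda>(V, w). sat TT V w \<phi>)"

text \<open>Such a predicate is recovered from the set of profiles \<open>{g \<in> G. g x}\<close>
  of the points satisfying it, which is a subset of \<open>Pow G\<close>.\<close>

lemma finite_determined_predicates:
  fixes G :: "('x \<Rightarrow> bool) set"
  assumes "finite G"
  shows "finite {e :: 'x \<Rightarrow> bool. \<forall>x y. (\<forall>g\<in>G. g x = g y) \<longrightarrow> e x = e y}" (is "finite ?S")
proof (rule finite_imageD)
  let ?c = "\<lambda>e. {{g \<in> G. g x} | x. e x}"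
  have "?c ` ?S \<subseteq> Pow (Pow G)" by auto
  then show "finite (?c ` ?S)" using assms by (meson finite_Pow_iff finite_subset)
  show "inj_on ?c ?S"
  proof (rule inj_onI)
    have sub: "e' x" if "e' \<in> ?S" "?c e = ?c e'" "e x" for e e' x
    proof -
      have "{g \<in> G. g x} \<in> ?c e" using that(3) by blast
      then have "{g \<in> G. g x} \<in> ?c e'" using that(2) by simp
      then obtain y where "{g \<in> G. g x} = {g \<in> G. g y}" "e' y" by auto
      then show ?thesis using that(1) by blast
    qed
    fix e e' assume "e \<in> ?S" "e' \<in> ?S" "?c e = ?c e'"
    then show "e = e'" using sub[of e' e] sub[of e e'] by (intro ext) metis
  qed
qed

lemma extension_determined:
  assumes "\<And>p. p < k \<Longrightarrow> extension (Var p) \<in> G"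
    and "\<And>m \<psi>. Dia m \<psi> \<in> fms_depth k d \<Longrightarrow> extension (Dia m \<psi>) \<in> G"
    and "\<forall>g\<in>G. g x = g y" "\<phi> \<in> fms_depth k d"
  shows "extension \<phi> x = extension \<phi> y"
  using assms(4)
proof (induction \<phi>)
  case (Imp \<phi> \<psi>)
  moreover have "extension (Imp \<phi> \<psi>) z \<longleftrightarrow> (extension \<phi> z \<longrightarrow> extension \<psi> z)" for z
    by (cases z) (simp add: extension_def)
  ultimately show ?case by simp
next
  case Bot
  then show ?case by (cases x; cases y) (simp add: extension_def)
qed (use assms(1-3) in auto)

text \<open>At depth \<open>Suc d\<close> a formula is a Boolean combination of variables and
  diamonds over depth \<open>d\<close>, and by induction these diamonds have finitely many
  extensions.\<close>

lemma finite_extensions: "finite (extension ` fms_depth k d)"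
proof (induction d)
  case 0
  let ?G = "(\<lambda>p. extension (Var p)) ` {..<k}"
  have fin: "finite ?G" by simp
  have "\<forall>x y. (\<forall>g\<in>?G. g x = g y) \<longrightarrow> extension \<phi> x = extension \<phi> y"
    if "\<phi> \<in> fms_depth k 0" for \<phi>
    using that extension_determined[of k ?G 0 _ _ \<phi>] by auto
  then have "extension ` fms_depth k 0 \<subseteq> {e. \<forall>x y. (\<forall>g\<in>?G. g x = g y) \<longrightarrow> e x = e y}"
    by (intro image_subsetI CollectI)
  then show ?case by (rule finite_subset[OF _ finite_determined_predicates[OF fin]])
next
  case (Suc d)
  define dm where "dm m e = (\<lambda>(V, w). \<exists>u\<in>worlds TT. (w, u) \<in> rel TT m \<and> e (V, u))"
    for m and e :: "(nat \<Rightarrow> (nat \<times> nat) option set) \<times> (nat \<times> nat) option \<Rightarrow> bool"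
  have dm: "extension (Dia m \<phi>) = dm m (extension \<phi>)" for m \<phi>
    by (auto simp: dm_def extension_def sat.simps)
  let ?G = "(\<lambda>p. extension (Var p)) ` {..<k} \<union> dm M1 ` extension ` fms_depth k d
     \<union> dm M2 ` extension ` fms_depth k d"
  have fin: "finite ?G" using Suc by simp
  have step: "extension (Dia m \<psi>) \<in> ?G" if "Dia m \<psi> \<in> fms_depth k (Suc d)" for m \<psi>
    using that by (cases m) (auto simp: dm)
  have "\<forall>x y. (\<forall>g\<in>?G. g x = g y) \<longrightarrow> extension \<phi> x = extension \<phi> y"
    if "\<phi> \<in> fms_depth k (Suc d)" for \<phi>
  proof (intro allI impI)
    fix x y assume "\<forall>g\<in>?G. g x = g y"
    from extension_determined[OF _ step this that] show "extension \<phi> x = extension \<phi> y" by auto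
  qed
  then have "extension ` fms_depth k (Suc d) \<subseteq> {e. \<forall>x y. (\<forall>g\<in>?G. g x = g y) \<longrightarrow> e x = e y}"
    by (intro image_subsetI CollectI)
  then show ?case by (rule finite_subset[OF _ finite_determined_predicates[OF fin]])
qed

text \<open>One finite \<open>R\<close> serves every valuation. This later makes the relevant
  substitution instances a finite set independent of the model.\<close>

lemma finite_representatives:
  "\<exists>R. finite R \<and> R \<subseteq> fms_depth k d \<and>
     (\<forall>\<phi>\<in>fms_depth k d. \<exists>\<psi>\<in>R. \<forall>V w. sat TT V w \<phi> \<longleftrightarrow> sat TT V w \<psi>)"
proof -
  from finite_extensions[of k d] obtain R where R: "R \<subseteq> fms_depth k d" "finite R"
    "extension ` fms_depth k d = extension ` R"
    by (metis finite_subset_image subset_refl)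
  have "\<exists>\<psi>\<in>R. \<forall>V w. sat TT V w \<phi> \<longleftrightarrow> sat TT V w \<psi>" if \<phi>: "\<phi> \<in> fms_depth k d" for \<phi>
  proof -
    have "extension \<phi> \<in> extension ` R" using R \<phi> by blast
    then obtain \<psi> where \<psi>: "\<psi> \<in> R" "extension \<phi> = extension \<psi>" by blast
    have "sat TT V w \<phi> \<longleftrightarrow> sat TT V w \<psi>" for V w
      using fun_cong[OF \<psi>(2), of "(V, w)"] unfolding extension_def by simp
    then show ?thesis using \<psi> by blast
  qed
  with R show ?thesis by blast
qed

section \<open>Definable sets of points and of lines\<close>

text \<open>A line is named by the coordinate that it fixes: \<open>M1\<close> moves the first
  coordinate, so its lines are the rows, indexed by \<open>b\<close>.\<close>

fun line :: "modality \<Rightarrow> nat \<times> nat \<Rightarrow> nat" where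
  "line M1 (a, b) = b"
| "line M2 (a, b) = a"

fun other :: "modality \<Rightarrow> modality" where
  "other M1 = M2"
| "other M2 = M1"

lemma other_eq_iff: "m' \<noteq> m \<longleftrightarrow> m' = other m"
  by (cases m; cases m') auto

lemma rel_TT [simp]:
  "(Some x, Some y) \<in> rel TT m \<longleftrightarrow> line m x = line m y"
  "(Some x, None) \<in> rel TT m \<longleftrightarrow> m = M1"
  "(None, Some y) \<notin> rel TT m"
  "(None, None) \<in> rel TT m"
  by (cases m; cases x; cases y; auto simp: rel_tack tack_rel1_def tack_rel2_def)+

locale tack_model =
  fixes k :: nat and V :: "nat \<Rightarrow> (nat \<times> nat) option set"
begin

definition Def :: "nat \<Rightarrow> (nat \<times> nat) option set set" where
  "Def d = (\<lambda>\<phi>. {w. sat TT V w \<phi>}) ` fms_depth k d"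

lemma DefI: "\<phi> \<in> fms_depth k d \<Longrightarrow> X = {w. sat TT V w \<phi>} \<Longrightarrow> X \<in> Def d"
  by (auto simp: Def_def)

lemma finite_Def: "finite (Def d)"
proof -
  have "Def d = (\<lambda>e. {w. e (V, w)}) ` extension ` fms_depth k d"
    by (simp add: Def_def image_image extension_def)
  then show ?thesis using finite_extensions by simp
qed

lemma Def_mono: "d \<le> e \<Longrightarrow> Def d \<subseteq> Def e"
  by (auto simp: Def_def fms_depth_def)

lemma Def_Var: "p < k \<Longrightarrow> V p \<in> Def d"
  by (rule DefI[of "Var p"]) auto

lemma Def_empty: "{} \<in> Def d"
  by (rule DefI[of Bot]) auto

lemma Def_Compl:
  assumes "X \<in> Def d" shows "- X \<in> Def d"
proof -
  obtain \<phi> where "\<phi> \<in> fms_depth k d" "X = {w. sat TT V w \<phi>}" using assms by (auto simp: Def_def)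
  then show ?thesis by (intro DefI[of "Neg \<phi>"]) (auto simp: Neg_def)
qed

lemma Def_Un:
  assumes "X \<in> Def d" "Y \<in> Def d" shows "X \<union> Y \<in> Def d"
proof -
  obtain \<phi> \<psi> where "\<phi> \<in> fms_depth k d" "X = {w. sat TT V w \<phi>}"
    "\<psi> \<in> fms_depth k d" "Y = {w. sat TT V w \<psi>}" using assms by (auto simp: Def_def)
  then show ?thesis by (intro DefI[of "Disj \<phi> \<psi>"]) (auto simp: Disj_def Neg_def)
qed

lemma Def_Int: "X \<in> Def d \<Longrightarrow> Y \<in> Def d \<Longrightarrow> X \<inter> Y \<in> Def d"
  using Def_Compl[OF Def_Un[OF Def_Compl Def_Compl, of X d Y]] by simp

lemma Def_UN:
  assumes "finite I" "\<And>i. i \<in> I \<Longrightarrow> X i \<in> Def d"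
  shows "(\<Union>i\<in>I. X i) \<in> Def d"
  using assms by (induction I) (auto intro: Def_empty Def_Un)

lemma Def_INT:
  assumes "finite I" "\<And>i. i \<in> I \<Longrightarrow> X i \<in> Def d"
  shows "(\<Inter>i\<in>I. X i) \<in> Def d"
  using Def_Compl[OF Def_UN[of I "\<lambda>i. - X i" d]] assms Def_Compl by simp

lemma Def_Dia:
  assumes "X \<in> Def d" shows "{w. \<exists>u. (w, u) \<in> rel TT m \<and> u \<in> X} \<in> Def (Suc d)"
proof -
  obtain \<phi> where "\<phi> \<in> fms_depth k d" "X = {w. sat TT V w \<phi>}" using assms by (auto simp: Def_def)
  then show ?thesis
    using worlds_TT by (intro DefI[of "Dia m \<phi>"]) (auto simp: sat.simps simp del: worlds_tack)
qed

section \<open>Colours of points and types of lines\<close>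

definition colour :: "(nat \<times> nat) option \<Rightarrow> nat set" where
  "colour w = {p. p < k \<and> w \<in> V p}"

lemma Def_colour: "{w. colour w = C} \<in> Def d"
proof (cases "C \<subseteq> {..<k}")
  case True
  then have "{w. colour w = C} = (\<Inter>p\<in>{..<k}. if p \<in> C then V p else - V p)"
    by (auto simp: colour_def split: if_splits)
  moreover have "\<dots> \<in> Def d" by (rule Def_INT) (auto intro: Def_Var Def_Compl)
  ultimately show ?thesis by simp
next
  case False
  then have "{w. colour w = C} = {}" by (auto simp: colour_def)
  then show ?thesis using Def_empty by simp
qed

definition cylinder :: "modality \<Rightarrow> nat set \<Rightarrow> (nat \<times> nat) option set" where
  "cylinder m I = Some ` {x. line m x \<in> I}"

definition DefLines :: "modality \<Rightarrow> nat \<Rightarrow> nat set set" where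
  "DefLines m d = {I. cylinder m I \<in> Def d}"

text \<open>Equal types mean that no definable set of lines at depth \<open>d\<close> separates the
  two lines.\<close>

definition line_type :: "modality \<Rightarrow> nat \<Rightarrow> nat \<Rightarrow> nat set set" where
  "line_type m d i = {I \<in> DefLines m d. i \<in> I}"

lemma Some_in_cylinder: "Some x \<in> cylinder m I \<longleftrightarrow> line m x \<in> I"
  by (auto simp: cylinder_def)

lemma line_surj: "\<exists>x. line m x = i"
  by (cases m) auto

lemma inj_cylinder: "inj (cylinder m)"
proof (rule injI)
  fix I I' assume eq: "cylinder m I = cylinder m I'"
  have "i \<in> I \<longleftrightarrow> i \<in> I'" for i
  proof -
    obtain x where "line m x = i" using line_surj by blast
    then show ?thesis using eq Some_in_cylinder by metis
  qed
  then show "I = I'" by blast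
qed

lemma finite_DefLines: "finite (DefLines m d)"
proof (rule finite_imageD)
  show "finite (cylinder m ` DefLines m d)"
    by (rule finite_subset[OF _ finite_Def[of d]]) (auto simp: DefLines_def)
  show "inj_on (cylinder m) (DefLines m d)" using inj_cylinder by (rule inj_on_subset) simp
qed

lemma DefLines_mono: "d \<le> e \<Longrightarrow> DefLines m d \<subseteq> DefLines m e"
  using Def_mono by (auto simp: DefLines_def)

lemma finite_line_types: "finite (range (line_type m d))"
  by (rule finite_subset[of _ "Pow (DefLines m d)"]) (auto simp: line_type_def finite_DefLines)

lemma card_line_types_mono:
  assumes "d \<le> e"
  shows "card (range (line_type m d)) \<le> card (range (line_type m e))"
proof -
  have "line_type m d i = line_type m e i \<inter> DefLines m d" for i
    using DefLines_mono[OF assms, of m] by (auto simp: line_type_def)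
  then have "range (line_type m d) = (\<lambda>S. S \<inter> DefLines m d) ` range (line_type m e)"
    by (simp add: image_image)
  then show ?thesis using finite_line_types by (metis card_image_le)
qed

text \<open>A definable set of lines is a union of classes of lines of equal type.\<close>

lemma card_DefLines: "card (DefLines m d) \<le> 2 ^ card (range (line_type m d))"
proof -
  have "I \<in> (\<lambda>P. line_type m d -` P) ` Pow (range (line_type m d))" if "I \<in> DefLines m d" for I
  proof
    show "I = line_type m d -` (line_type m d ` I)"
    proof (intro set_eqI iffI)
      fix i assume "i \<in> line_type m d -` (line_type m d ` I)"
      then obtain j where "j \<in> I" "line_type m d i = line_type m d j" by auto
      then have "I \<in> line_type m d i" using that by (simp add: line_type_def)
      then show "i \<in> I" by (simp add: line_type_def)
    qed auto
  qed auto
  then have "card (DefLines m d) \<le> card ((\<lambda>P. line_type m d -` P) ` Pow (range (line_type m d)))"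
    by (intro card_mono) (auto simp: finite_line_types)
  also have "\<dots> \<le> card (Pow (range (line_type m d)))"
    by (intro card_image_le) (simp add: finite_line_types)
  finally show ?thesis by (simp add: card_Pow finite_line_types)
qed

end

section \<open>Models with at least two colours, where the top point is definable\<close>

locale coloured_tack_model = tack_model +
  assumes not_monochrome: "\<exists>w. colour w \<noteq> colour None"
begin

text \<open>The top point is the only one from which no other colour can be reached.\<close>

lemma Def_top:
  assumes "2 \<le> d" shows "{None} \<in> Def d"
proof -
  obtain w where w: "colour w \<noteq> colour None" using not_monochrome by blast
  then obtain a b where ab: "w = Some (a, b)" by (cases w) auto
  let ?B = "- {w. colour w = colour None}"
  let ?D = "\<lambda>m X. {w. \<exists>u. (w, u) \<in> rel TT m \<and> u \<in> X}"
  have eq: "{None} = - ?D M1 (?D M2 ?B)"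
  proof (intro set_eqI)
    fix x
    show "x \<in> {None} \<longleftrightarrow> x \<in> - ?D M1 (?D M2 ?B)"
    proof (cases x)
      case None
      have "u = None" if "(None, u) \<in> rel TT m" for u m using that by (cases u) auto
      with None show ?thesis by blast
    next
      case (Some y)
      then obtain a' b' where x: "x = Some (a', b')" by (metis surj_pair)
      have "(x, Some (a, b')) \<in> rel TT M1" "(Some (a, b'), w) \<in> rel TT M2"
        by (simp_all add: x ab)
      then show ?thesis using w x by blast
    qed
  qed
  have "?D M1 (?D M2 ?B) \<in> Def (Suc (Suc 0))"
    by (intro Def_Dia Def_Compl Def_colour)
  then have "{None} \<in> Def (Suc (Suc 0))" unfolding eq by (rule Def_Compl)
  then show ?thesis using Def_mono[of "Suc (Suc 0)" d] assms by auto
qed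

text \<open>The lines meeting \<open>X\<close> are obtained by one diamond. The top point is first
  removed from \<open>X\<close>, since along \<open>M1\<close> every point sees it; this needs the
  top to be definable at depth \<open>d\<close>.\<close>

lemma DefLines_Dia:
  assumes "X \<in> Def d" "2 \<le> d"
  shows "{i. \<exists>x. line m x = i \<and> Some x \<in> X} \<in> DefLines m (Suc d)"
proof -
  have "cylinder m {i. \<exists>x. line m x = i \<and> Some x \<in> X} =
     {w. \<exists>u. (w, u) \<in> rel TT m \<and> u \<in> X \<inter> - {None}} \<inter> - {None}"
  proof (intro set_eqI)
    fix w
    show "w \<in> cylinder m {i. \<exists>x. line m x = i \<and> Some x \<in> X} \<longleftrightarrow>
      w \<in> {w. \<exists>u. (w, u) \<in> rel TT m \<and> u \<in> X \<inter> - {None}} \<inter> - {None}"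
    proof (cases w)
      case (Some y)
      have "(\<exists>u. (Some y, u) \<in> rel TT m \<and> u \<in> X \<and> u \<noteq> None) \<longleftrightarrow> (\<exists>x. line m y = line m x \<and> Some x \<in> X)"
        by (simp add: split_option_ex)
      then show ?thesis by (simp add: Some Some_in_cylinder eq_commute[of "line m y"])
    qed (auto simp: cylinder_def)
  qed
  moreover have "\<dots> \<in> Def (Suc d)"
    using assms by (intro Def_Int Def_Dia Def_Compl Def_top) auto
  ultimately show ?thesis by (simp add: DefLines_def)
qed

text \<open>The class is cut out by finitely many cylinders and their complements; the complements
  contain the top point, which is cut off at the end.\<close>

lemma Def_line_type:
  assumes "2 \<le> d" shows "Some ` {x. line_type m d (line m x) = S} \<in> Def d"
proof (cases "S \<subseteq> DefLines m d")
  case True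
  then have "Some ` {x. line_type m d (line m x) = S} =
    (\<Inter>I\<in>DefLines m d. if I \<in> S then cylinder m I else - cylinder m I) \<inter> - {None}" (is "?L = ?R")
  proof (intro set_eqI)
    fix w show "w \<in> ?L \<longleftrightarrow> w \<in> ?R"
    proof (cases w)
      case (Some y)
      have "w \<in> ?L \<longleftrightarrow> (\<forall>I\<in>DefLines m d. line m y \<in> I \<longleftrightarrow> I \<in> S)"
        using True by (auto simp: Some line_type_def)
      moreover have "w \<in> ?R \<longleftrightarrow> (\<forall>I\<in>DefLines m d. line m y \<in> I \<longleftrightarrow> I \<in> S)"
        unfolding Some Int_iff INT_iff by (auto simp: Some_in_cylinder split: if_splits)
      ultimately show ?thesis by simp
    qed auto
  qed
  moreover have "?R \<in> Def d"
    using assms finite_DefLines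
    by (intro Def_Int Def_Compl Def_top Def_INT) (auto simp: DefLines_def intro: Def_Compl)
  ultimately show ?thesis by simp
next
  case False
  then have "Some ` {x. line_type m d (line m x) = S} = {}" by (auto simp: line_type_def)
  then show ?thesis using Def_empty by (simp only:)
qed

text \<open>A finite union of type classes costs no new diamond. Hence any map that factors through
  the line type has definable fibres.\<close>

lemma line_type_saturated_DefLines:
  assumes "2 \<le> d"
  shows "{i. line_type m d i \<in> P} \<in> DefLines m d"
proof -
  have "cylinder m {i. line_type m d i \<in> P} =
    (\<Union>S\<in>P \<inter> range (line_type m d). Some ` {x. line_type m d (line m x) = S})"
    by (auto simp: cylinder_def)
  moreover have "\<dots> \<in> Def d"
    using assms finite_line_types by (intro Def_UN Def_line_type) auto
  ultimately show ?thesis by (simp add: DefLines_def)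
qed

end

section \<open>Few lines give a small quotient\<close>

lemma chain_stabilises:
  fixes S :: "nat \<Rightarrow> 'x set"
  assumes "\<And>e. S e \<subseteq> S (Suc e)" "\<And>e. finite (S e)" "card (S E) < E"
  shows "\<exists>e<E. S e = S (Suc e)"
proof (rule ccontr)
  assume "\<not> ?thesis"
  then have strict: "S e \<subset> S (Suc e)" if "e < E" for e using assms(1) that by blast
  have "e \<le> E \<Longrightarrow> e \<le> card (S e)" for e
  proof (induction e)
    case (Suc e)
    then show ?case using psubset_card_mono[OF assms(2) strict, of e] by simp
  qed simp
  from this[of E] show False using assms(3) by simp
qed

context tack_model
begin

text \<open>The kernel of \<open>g\<close> is a bisimulation for the first \<open>k\<close>
  variables; the back condition follows from the symmetry of equality.\<close>

definition bisimulation_map :: "((nat \<times> nat) option \<Rightarrow> 'c) \<Rightarrow> bool" where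
  "bisimulation_map g \<longleftrightarrow> (\<forall>x y. g x = g y \<longrightarrow> colour x = colour y \<and>
     (\<forall>m u. (x, u) \<in> rel TT m \<longrightarrow> (\<exists>v. (y, v) \<in> rel TT m \<and> g u = g v)))"

lemma bisimulation_mapD:
  assumes "bisimulation_map g" "g x = g y"
  shows "colour x = colour y"
    and "(x, u) \<in> rel TT m \<Longrightarrow> \<exists>v. (y, v) \<in> rel TT m \<and> g u = g v"
proof -
  have "colour x = colour y \<and>
     (\<forall>m u. (x, u) \<in> rel TT m \<longrightarrow> (\<exists>v. (y, v) \<in> rel TT m \<and> g u = g v))"
    using assms(1)[unfolded bisimulation_map_def, rule_format, OF assms(2)] by (intro conjI allI impI) simp_all
  then show "colour x = colour y"
    and "(x, u) \<in> rel TT m \<Longrightarrow> \<exists>v. (y, v) \<in> rel TT m \<and> g u = g v" by simp_all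
qed

text \<open>With at most \<open>n\<close> types there are at most \<open>2 ^ n\<close> definable
  sets of lines, too few for \<open>2 ^ n + 1\<close> strict increases. Steps have length two
  because matching points across lines of one type costs two diamonds; depths start at two for the
  sake of the top point.\<close>

lemma stable_depth:
  assumes "card (range (line_type m (2 + 2 * (2 ^ n + 1)))) \<le> n"
  shows "\<exists>d\<ge>2. DefLines m (Suc (Suc d)) = DefLines m d \<and> card (range (line_type m d)) \<le> n"
proof -
  define S where "S e = DefLines m (2 + 2 * e)" for e
  have "card (S (2 ^ n + 1)) \<le> 2 ^ card (range (line_type m (2 + 2 * (2 ^ n + 1))))"
    unfolding S_def by (rule card_DefLines)
  also have "\<dots> \<le> 2 ^ n" using assms by (intro power_increasing) auto
  finally have "card (S (2 ^ n + 1)) < 2 ^ n + 1" by simp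
  moreover have "S e \<subseteq> S (Suc e)" for e unfolding S_def by (rule DefLines_mono) simp
  moreover have "finite (S e)" for e unfolding S_def by (rule finite_DefLines)
  ultimately obtain e where e: "e < 2 ^ n + 1" "S e = S (Suc e)"
    using chain_stabilises[of S "2 ^ n + 1"] by blast
  have "card (range (line_type m (2 + 2 * e))) \<le> n"
    by (rule order_trans[OF card_line_types_mono assms]) (use e(1) in simp)
  then show ?thesis using e(2) by (intro exI[of _ "2 + 2 * e"]) (simp add: S_def)
qed

text \<open>The index \<open>j\<close> is a line of the direction other than \<open>m\<close>.\<close>

definition cross_kind :: "modality \<Rightarrow> nat \<Rightarrow> nat \<Rightarrow> (nat set \<times> nat set set) set" where
  "cross_kind m d j = {(colour (Some x), line_type m d (line m x)) | x. line (other m) x = j}"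

end

context coloured_tack_model
begin

lemma mem_cross_kind:
  "(colour (Some x), line_type m d (line m x)) \<in> cross_kind m d (line (other m) x)"
  unfolding cross_kind_def mem_Collect_eq by (rule exI[of _ x]) simp

text \<open>The lines containing a given pair of colour and type are found by one diamond, and a
  kind is a Boolean condition over finitely many pairs.\<close>

lemma Def_cross_kind:
  assumes "2 \<le> d" shows "Some ` {x. cross_kind m d (line (other m) x) = K} \<in> Def (Suc d)"
proof -
  let ?Q = "Pow {..<k} \<times> range (line_type m d)"
  let ?J = "\<lambda>q. {j. q \<in> cross_kind m d j}"
  let ?c = "cylinder (other m)"
  have sub: "cross_kind m d j \<subseteq> ?Q" for j by (auto simp: cross_kind_def colour_def)
  have J: "?c (?J q) \<in> Def (Suc d)" for q
  proof -
    let ?X = "{w. colour w = fst q} \<inter> Some ` {x. line_type m d (line m x) = snd q}"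
    have "?X \<in> Def d" using assms by (intro Def_Int Def_colour Def_line_type)
    from DefLines_Dia[OF this assms, of "other m"]
    have "{j. \<exists>x. line (other m) x = j \<and> Some x \<in> ?X} \<in> DefLines (other m) (Suc d)" .
    moreover have "{j. \<exists>x. line (other m) x = j \<and> Some x \<in> ?X} = ?J q"
      by (cases q) (auto simp: cross_kind_def)
    ultimately show ?thesis by (simp add: DefLines_def)
  qed
  show ?thesis
  proof (cases "K \<subseteq> ?Q")
    case True
    let ?R = "(\<Inter>q\<in>?Q. if q \<in> K then ?c (?J q) else - ?c (?J q)) \<inter> - {None}"
    let ?L = "Some ` {x. cross_kind m d (line (other m) x) = K}"
    have "?L = ?R"
    proof (intro set_eqI)
      fix w show "w \<in> ?L \<longleftrightarrow> w \<in> ?R"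
      proof (cases w)
        case (Some y)
        have "w \<in> ?L \<longleftrightarrow> cross_kind m d (line (other m) y) = K" by (auto simp: Some)
        also have "\<dots> \<longleftrightarrow> (\<forall>q\<in>?Q. q \<in> cross_kind m d (line (other m) y) \<longleftrightarrow> q \<in> K)"
          using True sub[of "line (other m) y"] by blast
        also have "\<dots> \<longleftrightarrow> w \<in> ?R"
          unfolding Some Int_iff INT_iff by (simp add: Some_in_cylinder if_bool_eq_conj) blast
        finally show ?thesis .
      qed auto
    qed
    moreover have "?R \<in> Def (Suc d)"
      using assms finite_line_types J
      by (intro Def_Int Def_Compl Def_top Def_INT) (auto intro: Def_Compl)
    ultimately show ?thesis by (simp only:)
  next
    case False
    then have "{x. cross_kind m d (line (other m) x) = K} = {}" using sub by blast
    then show ?thesis using Def_empty by (simp only: image_empty)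
  qed
qed

text \<open>The points that look like \<open>x\<close> form a definable set at depth
  \<open>d + 1\<close>; the lines meeting it are definable at depth \<open>d + 2\<close>, hence at
  depth \<open>d\<close> by stability. So lines of the same type all meet this set or all miss
  it.\<close>

lemma line_type_match:
  assumes "2 \<le> d" "DefLines m (Suc (Suc d)) = DefLines m d"
    and "line_type m d (line m x) = line_type m d i"
  shows "\<exists>y. line m y = i \<and> colour (Some y) = colour (Some x) \<and>
    cross_kind m d (line (other m) y) = cross_kind m d (line (other m) x)"
proof -
  let ?X = "{w. colour w = colour (Some x)} \<inter>
    Some ` {y. cross_kind m d (line (other m) y) = cross_kind m d (line (other m) x)}"
  let ?I = "{i. \<exists>y. line m y = i \<and> Some y \<in> ?X}"
  have "?X \<in> Def (Suc d)" using assms(1) by (intro Def_Int Def_colour Def_cross_kind)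
  then have "?I \<in> DefLines m (Suc (Suc d))" using assms(1) by (intro DefLines_Dia) auto
  moreover have "line m x \<in> ?I" by blast
  ultimately have "?I \<in> line_type m d (line m x)" unfolding line_type_def assms(2) by blast
  then have "i \<in> ?I" unfolding assms(3) by (simp add: line_type_def)
  then show ?thesis by auto
qed

text \<open>At a stable depth the line type answers moves along \<open>m\<close>, and the crossing
  kind answers moves along \<open>other m\<close>. The bound counts the top point,
  \<open>2 ^ k\<close> colours, \<open>n\<close> types and all sets of pairs of a colour and a
  type.\<close>

lemma small_quotient:
  assumes "card (range (line_type m (2 + 2 * (2 ^ n + 1)))) \<le> n"
  shows "\<exists>g :: (nat \<times> nat) option \<Rightarrow> (nat set \<times> nat set set \<times> (nat set \<times> nat set set) set) option.
    bisimulation_map g \<and> finite (range g) \<and> card (range g) \<le> 1 + 2 ^ k * (n * 2 ^ (2 ^ k * n))"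
proof -
  obtain d where d: "2 \<le> d" "DefLines m (Suc (Suc d)) = DefLines m d"
    and n: "card (range (line_type m d)) \<le> n"
    using stable_depth[OF assms] by blast
  define g where "g = map_option (\<lambda>x. (colour (Some x), line_type m d (line m x),
     cross_kind m d (line (other m) x)))"
  have g: "g None = None" "g (Some x) = Some (colour (Some x), line_type m d (line m x),
     cross_kind m d (line (other m) x))" for x by (simp_all add: g_def)
  have "colour x = colour y \<and>
     (\<forall>m' u. (x, u) \<in> rel TT m' \<longrightarrow> (\<exists>v. (y, v) \<in> rel TT m' \<and> g u = g v))" if eq: "g x = g y" for x y
  proof (cases x)
    case None
    then have "y = None" using eq by (cases y) (auto simp: g)
    with None show ?thesis by blast
  next
    case (Some a)
    then obtain b where b: "y = Some b" using eq by (cases y) (auto simp: g)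
    have ab: "colour (Some a) = colour (Some b)" "line_type m d (line m a) = line_type m d (line m b)"
       "cross_kind m d (line (other m) a) = cross_kind m d (line (other m) b)"
      using eq by (auto simp: Some b g)
    have "\<exists>v. (y, v) \<in> rel TT m' \<and> g u = g v" if u: "(x, u) \<in> rel TT m'" for m' u
    proof (cases u)
      case None
      then show ?thesis using u by (intro exI[of _ None]) (auto simp: Some b)
    next
      case (Some c)
      have ac: "line m' a = line m' c" using u by (simp add: Some \<open>x = Some a\<close>)
      show ?thesis
      proof (cases "m' = m")
        case True
        have "line_type m d (line m c) = line_type m d (line m b)" using ab(2) ac True by simp
        from line_type_match[OF d this] obtain z where z: "line m z = line m b"
          "colour (Some z) = colour (Some c)"
          "cross_kind m d (line (other m) z) = cross_kind m d (line (other m) c)" by blast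
        then have "g u = g (Some z)" using ab(2) ac True by (simp add: g Some)
        moreover have "(y, Some z) \<in> rel TT m'" using z True by (simp add: b)
        ultimately show ?thesis by blast
      next
        case False
        then have m': "m' = other m" by (simp add: other_eq_iff)
        have "(colour (Some c), line_type m d (line m c)) \<in> cross_kind m d (line (other m) b)"
          using mem_cross_kind[of c m d] ab(3) ac m' by simp
        then obtain z where z: "line (other m) z = line (other m) b" "colour (Some z) = colour (Some c)"
          "line_type m d (line m z) = line_type m d (line m c)" by (auto simp: cross_kind_def)
        then have "g u = g (Some z)" using ab(3) ac m' by (simp add: g Some)
        moreover have "(y, Some z) \<in> rel TT m'" using z m' by (simp add: b)
        ultimately show ?thesis by blast
      qed
    qed
    then show ?thesis using ab(1) by (simp add: Some b)
  qed
  then have bis: "bisimulation_map g"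
    unfolding bisimulation_map_def by (intro allI impI)
  let ?L = "range (line_type m d)"
  let ?B = "Pow {..<k} \<times> ?L \<times> Pow (Pow {..<k} \<times> ?L)"
  have finB: "finite ?B" using finite_line_types by simp
  have sub: "range g \<subseteq> insert None (Some ` ?B)"
  proof
    fix z assume "z \<in> range g"
    then obtain x where "z = g x" by blast
    then show "z \<in> insert None (Some ` ?B)"
      by (cases x) (auto simp: g colour_def cross_kind_def)
  qed
  have "card (range g) \<le> card (insert None (Some ` ?B))" using sub finB by (intro card_mono) auto
  also have "\<dots> \<le> 1 + card ?B"
    using finB card_insert_le_m1[of "1 + card ?B" "Some ` ?B" None] card_image_le[OF finB, of Some] by simp
  also have "card ?B = 2 ^ k * (card ?L * 2 ^ (2 ^ k * card ?L))"
    using finite_line_types by (simp add: card_cartesian_product card_Pow)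
  also have "1 + \<dots> \<le> 1 + 2 ^ k * (n * 2 ^ (2 ^ k * n))"
    using n by (intro add_left_mono mult_le_mono power_increasing) auto
  finally have "card (range g) \<le> 1 + 2 ^ k * (n * 2 ^ (2 ^ k * n))" .
  moreover have "finite (range g)" by (rule finite_subset[OF sub]) (use finB in simp)
  ultimately show ?thesis using bis by (intro exI[of _ g] conjI)
qed

end

section \<open>Many lines refute a substitution instance\<close>

lemma surjection_onto_smaller:
  assumes "finite T" "finite X" "X \<noteq> {}" "card X \<le> card T"
  shows "\<exists>q. q ` T = X"
  using assms inj_on_iff_card_le[of X T] inj_on_iff_surj[of X T] by blast

lemma finite_instances:
  assumes "finite R" shows "finite {subst \<sigma> \<phi> | \<sigma>. range \<sigma> \<subseteq> R}"
proof (induction \<phi>)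
  case (Var p)
  show ?case by (rule finite_subset[OF _ assms]) auto
next
  case Bot
  show ?case by (rule finite_subset[of _ "{Bot}"]) auto
next
  case (Imp \<phi> \<psi>)
  let ?S = "\<lambda>\<phi>. {subst \<sigma> \<phi> | \<sigma>. range \<sigma> \<subseteq> R}"
  have "?S (Imp \<phi> \<psi>) \<subseteq> (\<lambda>(a, b). Imp a b) ` (?S \<phi> \<times> ?S \<psi>)" by auto
  then show ?case using Imp finite_subset by blast
next
  case (Dia m \<phi>)
  let ?S = "\<lambda>\<phi>. {subst \<sigma> \<phi> | \<sigma>. range \<sigma> \<subseteq> R}"
  have "?S (Dia m \<phi>) \<subseteq> Dia m ` ?S \<phi>" by auto
  then show ?case using Dia finite_subset by blast
qed

text \<open>Sending each line to a coordinate according to its type gives a bounded morphism onto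
  the finite tack. Its fibres are definable, so the refuting valuation pulls back to formulas to be
  substituted. Columns are \<open>M2\<close> lines and supply the first coordinate, so their types
  must cover \<open>X\<close>.\<close>

lemma (in coloured_tack_model) refuted_instance:
  fixes X :: "'a set" and Y :: "'b set"
  assumes d: "2 \<le> d" and X: "finite X" "X \<noteq> {}" and Y: "finite Y" "Y \<noteq> {}"
    and cX: "card X \<le> card (range (line_type M2 d))" and cY: "card Y \<le> card (range (line_type M1 d))"
    and w0: "w0 \<in> worlds (tack X Y)" "\<not> sat (tack X Y) V0 w0 \<phi>"
    and R: "\<forall>\<phi>\<in>fms_depth k d. \<exists>\<psi>\<in>R. \<forall>V w. sat TT V w \<phi> \<longleftrightarrow> sat TT V w \<psi>"
  shows "\<exists>\<sigma> w. range \<sigma> \<subseteq> R \<and> \<not> sat TT V w (subst \<sigma> \<phi>)"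
proof -
  obtain q1 where q1: "q1 ` range (line_type M2 d) = X"
    using surjection_onto_smaller[OF finite_line_types X cX] by blast
  obtain q2 where q2: "q2 ` range (line_type M1 d) = Y"
    using surjection_onto_smaller[OF finite_line_types Y cY] by blast
  define h1 where "h1 a = q1 (line_type M2 d a)" for a
  define h2 where "h2 b = q2 (line_type M1 d b)" for b
  have h: "range h1 = X" "range h2 = Y" using q1 q2 by (auto simp: h1_def h2_def)
  have h1J: "cylinder M2 {a. h1 a = x} \<in> Def d" for x
    using line_type_saturated_DefLines[OF d, of M2 "q1 -` {x}"] by (simp add: h1_def DefLines_def)
  have h2J: "cylinder M1 {b. h2 b = y} \<in> Def d" for y
    using line_type_saturated_DefLines[OF d, of M1 "q2 -` {y}"] by (simp add: h2_def DefLines_def)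
  define f where "f = map_option (\<lambda>(a, b). (h1 a, h2 b))"
  have f: "f None = None" "f (Some (a, b)) = Some (h1 a, h2 b)" for a b by (simp_all add: f_def)
  have fibre: "{w. f w = z} \<in> Def d" for z
  proof (cases z)
    case None
    then have "{w. f w = z} = {None}" by (auto simp: f_def)
    then show ?thesis using Def_top[OF d] by simp
  next
    case (Some q)
    then obtain x y where z: "z = Some (x, y)" by (metis surj_pair)
    have "w \<in> {w. f w = z} \<longleftrightarrow> w \<in> cylinder M2 {a. h1 a = x} \<inter> cylinder M1 {b. h2 b = y}" for w
      by (cases w) (auto simp: f z Some_in_cylinder cylinder_def)
    then have "{w. f w = z} = cylinder M2 {a. h1 a = x} \<inter> cylinder M1 {b. h2 b = y}" by blast
    then show ?thesis using Def_Int[OF h1J h2J] by simp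
  qed
  have fw: "f w \<in> worlds (tack X Y)" for w
    using h by (cases w) (auto simp: f)
  have "\<exists>\<psi>\<in>R. {w. f w \<in> V0 p} = {w. sat TT V w \<psi>}" for p
  proof -
    \<comment> \<open>\<open>V0 p\<close> may contain elements outside the finite tack; cutting it
      down to the worlds leaves a finite union of fibres.\<close>
    have "{w. f w \<in> V0 p} = (\<Union>z\<in>V0 p \<inter> worlds (tack X Y). {w. f w = z})" using fw by auto
    moreover have "\<dots> \<in> Def d" using X Y fibre by (intro Def_UN) auto
    ultimately obtain \<psi> where \<psi>: "\<psi> \<in> fms_depth k d" "{w. f w \<in> V0 p} = {w. sat TT V w \<psi>}"
      by (auto simp: Def_def)
    obtain \<chi> where "\<chi> \<in> R" "\<forall>V w. sat TT V w \<psi> \<longleftrightarrow> sat TT V w \<chi>" using R \<psi>(1) by blast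
    then show ?thesis using \<psi>(2) by auto
  qed
  then obtain \<sigma> where \<sigma>: "\<And>p. \<sigma> p \<in> R" "\<And>p. {w. f w \<in> V0 p} = {w. sat TT V w (\<sigma> p)}"
    by metis
  have eq: "sat TT V w (subst \<sigma> \<psi>) \<longleftrightarrow> sat (tack X Y) V0 (f w) \<psi>" for w \<psi>
  proof (induction \<psi> arbitrary: w)
    case (Var p)
    then show ?case using \<sigma>(2)[of p] by auto
  next
    case (Dia m \<psi>)
    show ?case
    proof (cases w)
      case None
      then show ?thesis using Dia[of None] by (simp add: f)
    next
      case (Some q)
      then obtain a b where w: "w = Some (a, b)" by (metis surj_pair)
      have ab: "h1 a \<in> X" "h2 b \<in> Y" using h by auto
      show ?thesis
      proof (cases m)
        case M1
        have "(\<exists>x\<in>X. sat (tack X Y) V0 (Some (x, h2 b)) \<psi>) \<longleftrightarrow>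
            (\<exists>a'. sat (tack X Y) V0 (Some (h1 a', h2 b)) \<psi>)" unfolding h(1)[symmetric] by blast
        then show ?thesis by (simp add: M1 w f sat_tack_Some[OF ab] Dia)
      next
        case M2
        have "(\<exists>y\<in>Y. sat (tack X Y) V0 (Some (h1 a, y)) \<psi>) \<longleftrightarrow>
            (\<exists>b'. sat (tack X Y) V0 (Some (h1 a, h2 b')) \<psi>)" unfolding h(2)[symmetric] by blast
        then show ?thesis by (simp add: M2 w f sat_tack_Some[OF ab] Dia)
      qed
    qed
  qed auto
  have "\<exists>w. f w = w0"
  proof (cases w0)
    case None
    then show ?thesis using f by blast
  next
    case (Some q)
    then obtain x y where "w0 = Some (x, y)" "x \<in> X" "y \<in> Y" using w0(1) by auto
    moreover obtain a b where "h1 a = x" "h2 b = y" using h \<open>x \<in> X\<close> \<open>y \<in> Y\<close> by blast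
    ultimately show ?thesis using f(2) by blast
  qed
  then show ?thesis using eq w0(2) \<sigma>(1) by blast
qed

section \<open>Truth tables over models of bounded size\<close>

definition fin_frame :: "nat \<Rightarrow> (nat \<times> nat) set \<times> (nat \<times> nat) set \<Rightarrow> nat kripke_frame" where
  "fin_frame N r = \<lparr> worlds = {..<N}, rel = (\<lambda>m. case m of M1 \<Rightarrow> fst r | M2 \<Rightarrow> snd r) \<rparr>"

text \<open>Ranges over all models on the first \<open>N\<close> numbers, not only tacks. Coding the
  valuation of \<open>k\<close> variables as a set of pairs keeps the number of possible tables
  finite.\<close>

definition truth_table ::
  "nat \<Rightarrow> nat \<Rightarrow> fm \<Rightarrow> (((nat \<times> nat) set \<times> (nat \<times> nat) set) \<times> (nat \<times> nat) set \<times> nat) set" where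
  "truth_table N k \<phi> = {(r, v, u).
     r \<in> Pow ({..<N} \<times> {..<N}) \<times> Pow ({..<N} \<times> {..<N}) \<and> v \<in> Pow ({..<k} \<times> {..<N}) \<and> u < N \<and>
     sat (fin_frame N r) (\<lambda>p. {x. (p, x) \<in> v}) u \<phi>}"

lemma finite_truth_tables: "finite (range (truth_table N k))"
proof -
  let ?B = "(Pow ({..<N} \<times> {..<N}) \<times> Pow ({..<N} \<times> {..<N})) \<times> Pow ({..<k} \<times> {..<N}) \<times> {..<N}"
  have "range (truth_table N k) \<subseteq> Pow ?B"
    unfolding truth_table_def by blast
  moreover have "finite (Pow ?B)" by simp
  ultimately show ?thesis by (rule finite_subset)
qed

text \<open>The quotient by \<open>g\<close> can be copied onto numbers below \<open>N\<close>,
  which makes it one of the models in the table.\<close>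

lemma (in tack_model) truth_table_determines:
  assumes g: "bisimulation_map g" and fin: "finite (range g)" and N: "card (range g) \<le> N"
    and tt: "truth_table N k \<phi> = truth_table N k \<psi>" and fms: "\<phi> \<in> fms k" "\<psi> \<in> fms k"
  shows "sat TT V w \<phi> \<longleftrightarrow> sat TT V w \<psi>"
proof -
  obtain c where c: "inj_on c (range g)" "c ` range g \<subseteq> {..<N}"
    using inj_on_iff_card_le[of "range g" "{..<N}"] fin N by auto
  define f where "f w = c (g w)" for w
  have fN: "f w < N" for w using c(2) by (auto simp: f_def)
  have fg: "f x = f y \<longleftrightarrow> g x = g y" for x y using c(1) by (auto simp: f_def inj_on_def)
  \<comment> \<open>The relations are the images under \<open>f\<close>; numbers outside the range
    of \<open>f\<close> are isolated.\<close>
  define rm where "rm m = {(f x, f u) | x u. (x, u) \<in> rel TT m}" for m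
  define v where "v = {(p, f x) | p x. p < k \<and> x \<in> V p}"
  let ?F = "fin_frame N (rm M1, rm M2)"
  let ?V = "\<lambda>p. {x. (p, x) \<in> v}"
  have rmN: "z < N" if "(y, z) \<in> rm m" for y z m using that fN by (auto simp: rm_def)
  have rel_F: "rel ?F m = rm m" for m by (cases m) (auto simp: fin_frame_def)
  have worlds_F: "worlds ?F = {..<N}" by (simp add: fin_frame_def)
  have eq: "sat TT V w \<chi> \<longleftrightarrow> sat ?F ?V (f w) \<chi>" if "\<chi> \<in> fms k" for w \<chi>
    using that
  proof (induction \<chi> arbitrary: w)
    case (Var p)
    then have p: "p < k" by (simp add: fms_def)
    have "w \<in> V p" if "x \<in> V p" "f w = f x" for x
    proof -
      have "colour w = colour x" using bisimulation_mapD(1)[OF g] that(2) fg by blast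
      then show ?thesis using that(1) p by (auto simp: colour_def)
    qed
    then show ?case using p by (auto simp: v_def)
  next
    case (Dia m \<chi>)
    then have IH: "sat TT V u \<chi> \<longleftrightarrow> sat ?F ?V (f u) \<chi>" for u by (simp add: fms_def)
    have "sat TT V w (Dia m \<chi>) \<longleftrightarrow> (\<exists>u. (w, u) \<in> rel TT m \<and> sat TT V u \<chi>)"
      using worlds_TT by (auto simp: sat.simps simp del: worlds_tack)
    also have "\<dots> \<longleftrightarrow> (\<exists>z. (f w, z) \<in> rm m \<and> sat ?F ?V z \<chi>)"
    proof
      assume "\<exists>z. (f w, z) \<in> rm m \<and> sat ?F ?V z \<chi>"
      then obtain x u where xu: "f w = f x" "(x, u) \<in> rel TT m" "sat ?F ?V (f u) \<chi>"
        by (auto simp: rm_def)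
      have "g x = g w" using xu(1) fg by simp
      from bisimulation_mapD(2)[OF g this xu(2)]
      obtain u' where u': "(w, u') \<in> rel TT m" "g u = g u'" by blast
      have "f u = f u'" using u'(2) fg by simp
      then have "sat TT V u' \<chi>" using IH[of u'] xu(3) by simp
      then show "\<exists>u. (w, u) \<in> rel TT m \<and> sat TT V u \<chi>" using u'(1) by blast
    qed (use IH in \<open>auto simp: rm_def\<close>)
    also have "\<dots> \<longleftrightarrow> sat ?F ?V (f w) (Dia m \<chi>)"
      using rmN by (auto simp: sat.simps(4) rel_F worlds_F)
    finally show ?case .
  qed (auto simp: fms_def)
  have "(rm M1, rm M2) \<in> Pow ({..<N} \<times> {..<N}) \<times> Pow ({..<N} \<times> {..<N})" "v \<in> Pow ({..<k} \<times> {..<N})"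
    using fN by (auto simp: rm_def v_def)
  then have "((rm M1, rm M2), v, f w) \<in> truth_table N k \<chi> \<longleftrightarrow> sat ?F ?V (f w) \<chi>" for \<chi>
    using fN unfolding truth_table_def by blast
  then show ?thesis using tt eq fms by metis
qed

section \<open>Normal extensions\<close>

definition Box :: "modality \<Rightarrow> fm \<Rightarrow> fm" where
  "Box m \<phi> = Neg (Dia m (Neg \<phi>))"

lemma sat_Box_TT: "sat TT V w (Box m \<phi>) \<longleftrightarrow> (\<forall>u. (w, u) \<in> rel TT m \<longrightarrow> sat TT V u \<phi>)"
  using worlds_TT by (auto simp: Box_def sat.simps(4) simp del: worlds_tack)

lemma normal_logicD:
  assumes "normal_logic L"
  shows "tautology \<phi> \<Longrightarrow> \<phi> \<in> L"
    and "Neg (Dia m Bot) \<in> L"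
    and "Imp \<phi> \<psi> \<in> L \<Longrightarrow> \<phi> \<in> L \<Longrightarrow> \<psi> \<in> L"
    and "\<phi> \<in> L \<Longrightarrow> subst \<sigma> \<phi> \<in> L"
    and "Imp \<phi> \<psi> \<in> L \<Longrightarrow> Imp (Dia m \<phi>) (Dia m \<psi>) \<in> L"
  using assms unfolding normal_logic_def by blast+

lemma necessitation:
  assumes L: "normal_logic L" and "\<phi> \<in> L"
  shows "Box m \<phi> \<in> L"
proof -
  have "Imp \<phi> (Imp (Neg \<phi>) Bot) \<in> L"
    by (rule normal_logicD(1)[OF L]) (simp add: tautology_def)
  then have "Imp (Neg \<phi>) Bot \<in> L" using normal_logicD(3)[OF L] assms(2) by blast
  then have 1: "Imp (Dia m (Neg \<phi>)) (Dia m Bot) \<in> L" by (rule normal_logicD(5)[OF L])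
  have "Imp (Imp (Dia m (Neg \<phi>)) (Dia m Bot)) (Imp (Neg (Dia m Bot)) (Box m \<phi>)) \<in> L"
    by (rule normal_logicD(1)[OF L]) (auto simp: tautology_def Box_def)
  then show ?thesis using normal_logicD(2,3)[OF L] 1 by blast
qed

text \<open>Stands in for completeness of \<open>L\<close>: the finitely many boxed premises move
  one by one into an implication valid in the infinite tack, and are discharged by necessitation and
  modus ponens. At every point but the top, \<open>Box M1\<close> followed by \<open>Box M2\<close>
  acts as a universal modality.\<close>

lemma global_consequence:
  assumes L: "normal_logic L" "Tack2 \<subseteq> L" and "finite S" "S \<subseteq> L"
    and "\<And>V w. \<forall>s\<in>S. sat TT V w (Box M1 (Box M2 s)) \<Longrightarrow> sat TT V w \<chi>"
  shows "\<chi> \<in> L"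
  using assms(3-5)
proof (induction S arbitrary: \<chi>)
  case empty
  then have "\<chi> \<in> Tack2" by (simp add: Tack2_def valid_def)
  then show ?case using L by blast
next
  case (insert s S)
  have "Imp (Box M1 (Box M2 s)) \<chi> \<in> L" using insert.prems by (intro insert.IH) auto
  moreover have "Box M1 (Box M2 s) \<in> L" using insert.prems by (intro necessitation L) auto
  ultimately show ?case using normal_logicD(3)[OF L(1)] by blast
qed

lemma locally_tabular_if_finitely_many:
  assumes L: "normal_logic L"
    and "\<And>k. \<exists>t :: fm \<Rightarrow> 'x. finite (range t) \<and>
      (\<forall>\<phi>\<in>fms k. \<forall>\<psi>\<in>fms k. t \<phi> = t \<psi> \<longrightarrow> Iff \<phi> \<psi> \<in> L)"
  shows "locally_tabular L"
  unfolding locally_tabular_def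
proof
  fix k
  obtain t :: "fm \<Rightarrow> 'x" where t: "finite (range t)"
    "\<And>\<phi> \<psi>. \<phi> \<in> fms k \<Longrightarrow> \<psi> \<in> fms k \<Longrightarrow> t \<phi> = t \<psi> \<Longrightarrow> Iff \<phi> \<psi> \<in> L"
    using assms(2)[of k] by blast
  let ?c = "\<lambda>\<phi>. equivalent_in L k `` {\<phi>}"
  have step: "Iff \<psi> \<chi> \<in> L" if "Iff \<phi> \<psi> \<in> L" "Iff \<phi> \<chi> \<in> L" for \<phi> \<psi> \<chi>
  proof -
    have "Imp (Iff \<phi> \<psi>) (Imp (Iff \<phi> \<chi>) (Iff \<psi> \<chi>)) \<in> L"
      by (rule normal_logicD(1)[OF L]) (auto simp: tautology_def)
    then show ?thesis using normal_logicD(3)[OF L] that by blast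
  qed
  have sub: "?c \<phi> \<subseteq> ?c \<psi>" if "\<phi> \<in> fms k" "\<psi> \<in> fms k" "t \<phi> = t \<psi>" for \<phi> \<psi>
  proof
    fix \<chi> assume "\<chi> \<in> ?c \<phi>"
    then have "\<chi> \<in> fms k" "Iff \<phi> \<chi> \<in> L" by (simp_all add: equivalent_in_def)
    then show "\<chi> \<in> ?c \<psi>" using step[OF t(2)[OF that]] that(2) by (simp add: equivalent_in_def)
  qed
  have same: "?c \<phi> = ?c \<psi>" if "\<phi> \<in> fms k" "\<psi> \<in> fms k" "t \<phi> = t \<psi>" for \<phi> \<psi>
    using sub[OF that] sub[OF that(2,1) that(3)[symmetric]] by (rule subset_antisym)
  have "?c ` fms k \<subseteq> (\<lambda>z. ?c (inv_into (fms k) t z)) ` range t"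
  proof (rule image_subsetI)
    fix \<phi> assume \<phi>: "\<phi> \<in> fms k"
    have "?c \<phi> = ?c (inv_into (fms k) t (t \<phi>))"
      using \<phi> by (intro same) (auto simp: inv_into_into f_inv_into_f)
    then show "?c \<phi> \<in> (\<lambda>z. ?c (inv_into (fms k) t z)) ` range t" by blast
  qed
  moreover have "fms k // equivalent_in L k = ?c ` fms k" by (auto simp: quotient_def)
  ultimately show "finite (fms k // equivalent_in L k)"
    using finite_subset[OF _ finite_imageI[OF t(1)]] by simp
qed

text \<open>Covers the case where the top point cannot be told apart by colours: the model then
  collapses to a single point, since both relations are reflexive.\<close>

lemma monochrome_truth_table_determines:
  assumes "\<And>w. tack_model.colour k V w = tack_model.colour k V None" "1 \<le> N"
    and "truth_table N k \<phi> = truth_table N k \<psi>" "\<phi> \<in> fms k" "\<psi> \<in> fms k"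
  shows "sat TT V w \<phi> \<longleftrightarrow> sat TT V w \<psi>"
proof -
  have "(y, y) \<in> rel TT m" for y m by (cases y) auto
  moreover have "tack_model.colour k V x = tack_model.colour k V y" for x y
    using assms(1) by metis
  ultimately have "tack_model.bisimulation_map k V (\<lambda>_. 0 :: nat)"
    unfolding tack_model.bisimulation_map_def by blast
  then show ?thesis
    by (rule tack_model.truth_table_determines[where g = "\<lambda>_. 0 :: nat", OF _ _ _ assms(3-5)])
      (use assms(2) in simp_all)
qed

theorem theorem6p18: "prelocally_tabular Tack2"
  unfolding prelocally_tabular_def
proof (intro allI impI)
  fix L assume "normal_logic L \<and> Tack2 \<subset> L"
  then have L: "normal_logic L" "Tack2 \<subseteq> L" and "\<exists>\<phi>. \<phi> \<in> L \<and> \<phi> \<notin> Tack2" by auto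
  then obtain \<phi>0 where \<phi>0: "\<phi>0 \<in> L" "\<phi>0 \<notin> Tack2" by blast
  obtain X Y :: "(nat \<times> nat) set" and V0 w0 where XY: "finite X" "X \<noteq> {}" "finite Y" "Y \<noteq> {}"
    and w0: "w0 \<in> worlds (tack X Y)" "\<not> sat (tack X Y) V0 w0 \<phi>0"
    using tack_finite_model_property[OF \<phi>0(2)] by blast
  \<comment> \<open>With \<open>card X\<close> types of columns and \<open>card Y\<close> types of
    rows an instance is refuted; otherwise one direction has at most \<open>n\<close> types.\<close>
  define n where "n = max (card X) (card Y)"
  \<comment> \<open>The depth at which a bound of \<open>n\<close> line types guarantees a stable
    smaller depth.\<close>
  define D where "D = 2 + 2 * (2 ^ n + 1 :: nat)"
  show "locally_tabular L"
  proof (rule locally_tabular_if_finitely_many[OF L(1)])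
    fix k
    define N where "N = 1 + 2 ^ k * (n * 2 ^ (2 ^ k * n))"
    obtain R where R: "finite R"
      "\<forall>\<phi>\<in>fms_depth k D. \<exists>\<psi>\<in>R. \<forall>V w. sat TT V w \<phi> \<longleftrightarrow> sat TT V w \<psi>"
      using finite_representatives[of k D] by blast
    \<comment> \<open>\<open>R\<close> covers depth \<open>D\<close> for all valuations, so these
      finitely many instances of \<open>\<phi>0\<close> suffice for every model.\<close>
    define S where "S = {subst \<sigma> \<phi>0 | \<sigma>. range \<sigma> \<subseteq> R}"
    have "Iff \<phi> \<psi> \<in> L"
      if fms: "\<phi> \<in> fms k" "\<psi> \<in> fms k" and tt: "truth_table N k \<phi> = truth_table N k \<psi>" for \<phi> \<psi>
    proof (rule global_consequence[OF L])
      show "finite S" unfolding S_def by (rule finite_instances[OF R(1)])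
      show "S \<subseteq> L" using normal_logicD(4)[OF L(1) \<phi>0(1)] by (auto simp: S_def)
      fix V w assume S: "\<forall>s\<in>S. sat TT V w (Box M1 (Box M2 s))"
      show "sat TT V w (Iff \<phi> \<psi>)"
      proof (cases w)
        case None
        txt \<open>At the top point the rest of the model is irrelevant and may be given the same colour.\<close>
        define V' where "V' p = (if None \<in> V p then UNIV else {} :: (nat \<times> nat) option set)" for p
        have "sat TT V None \<chi> \<longleftrightarrow> sat TT V' None \<chi>" for \<chi>
          by (induction \<chi>) (auto simp: V'_def)
        moreover have "sat TT V' None \<phi> \<longleftrightarrow> sat TT V' None \<psi>"
          by (rule monochrome_truth_table_determines[OF _ _ tt fms])
            (auto simp: N_def V'_def tack_model.colour_def)
        ultimately show ?thesis by (simp add: None)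
      next
        case (Some q)
        then obtain a b where w: "w = Some (a, b)" by (metis surj_pair)
        \<comment> \<open>From \<open>(a, b)\<close>, a move along \<open>M1\<close> to
          \<open>(a', b)\<close> and then one along \<open>M2\<close> reach any pair
          \<open>(a', b')\<close>; the top point is reached as well.\<close>
        have glob: "sat TT V u s" if "s \<in> S" for u s
        proof -
          have *: "sat TT V u s" if "(w, v) \<in> rel TT M1" "(v, u) \<in> rel TT M2" for u v
            using S \<open>s \<in> S\<close> that by (auto simp: sat_Box_TT)
          show ?thesis
          proof (cases u)
            case None
            then show ?thesis using *[of None] by (simp add: w)
          next
            case (Some q)
            then obtain a' b' where "u = Some (a', b')" by (metis surj_pair)
            then show ?thesis using *[of "Some (a', b)" u] by (simp add: w)
          qed
        qed
        show ?thesis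
        proof (cases "\<exists>w. tack_model.colour k V w \<noteq> tack_model.colour k V None")
          case True
          then interpret coloured_tack_model k V by unfold_locales
          \<comment> \<open>Otherwise some instance in \<open>S\<close> would fail at a point,
            against \<open>glob\<close>.\<close>
          have "\<not> (card X \<le> card (range (line_type M2 D)) \<and> card Y \<le> card (range (line_type M1 D)))"
            using refuted_instance[OF _ XY _ _ w0 R(2)] glob unfolding S_def D_def by fastforce
          then obtain m where "card (range (line_type m D)) \<le> n"
            unfolding n_def by (metis max.coboundedI1 max.coboundedI2 nat_le_linear)
          from small_quotient[OF this[unfolded D_def]] show ?thesis
            using truth_table_determines[OF _ _ _ tt fms] unfolding N_def by auto
        next
          case False
          then show ?thesis
            using monochrome_truth_table_determines[OF _ _ tt fms, of V] by (simp add: N_def)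
        qed
      qed
    qed
    then show "\<exists>t :: fm \<Rightarrow> (((nat \<times> nat) set \<times> (nat \<times> nat) set) \<times> (nat \<times> nat) set \<times> nat) set.
      finite (range t) \<and> (\<forall>\<phi>\<in>fms k. \<forall>\<psi>\<in>fms k. t \<phi> = t \<psi> \<longrightarrow> Iff \<phi> \<psi> \<in> L)"
      using finite_truth_tables[of N k] by (intro exI[of _ "truth_table N k"]) blast
  qed
qed

end
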